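(* Let $\lambda,P_t,C,D>0$ and $\alpha>2$ be real numbers, and put $z=P_tC$, $x_{2,0}=1$, and $x_{2,k}=kD$ for integers $k\ge1$. Let $(\Phi_k)_{k\ge0}$ be independent homogeneous Poisson point processes on $\mathbb{R}$, each of intensity $\lambda$, whose points $x_i$ carry i.i.d. marks $h_i\sim\exp(1)$ (exponential with mean $1$), independent of all the point processes. Let $$I_{\Phi}=\sum_{k=0}^{\infty}\ \sum_{x_i\in\Phi_k}P_t\,h_i\,l(x_i,x_{2,k}),\qquad l(x_1,x_2)=C\,|x_1|^{-2}x_2^{-\alpha}.$$ Then the Laplace transform of $I_\Phi$ is, for every $s>0$, $$\mathcal{L}_{I_{\Phi(z)}}(s)=\mathbb{E}\left[e^{-sI_\Phi}\right]=\exp\left[-\pi\lambda\left\{1+\zeta\left(\tfrac{\alpha}{2}\right)D^{-\alpha/2}\right\}\sqrt{sz}\right],$$ where $\zeta$ denotes the Riemann zeta function.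
   Context: Interpretation: $\Phi_k$ is the set of positions of transmitting cars along the $k$-th vertical street of a Manhattan street grid, $D$ is the distance between neighbouring streets, $P_t$ is the transmit power, $h_i$ is the Rayleigh fading power gain, $l$ is the (singular) path loss, and $I_\Phi$ is the total interference from all vertical streets $k=0,1,2,\dots$. The convention $e^{-\infty}=0$ is used. *)

theory Defs
  imports "HOL-Probability.Probability"
begin

text \<open>A point process on the real line is a random set of points. Its counts are taken with
  values in the extended nonnegative reals, so that an infinite set has count \<open>\<infinity>\<close>
  (and not \<open>0\<close>, as with \<^const>\<open>card\<close>).\<close>

definition num_points :: "real set \<Rightarrow> real set \<Rightarrow> ennreal" where
  "num_points S B = emeasure (count_space UNIV) (S \<inter> B)"

text \<open>Local finiteness of almost every realization follows from the Poisson law of the counts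
  of bounded sets.\<close>

definition homogeneous_poisson_process ::
    "'w measure \<Rightarrow> real \<Rightarrow> ('w \<Rightarrow> real set) \<Rightarrow> bool" where
  "homogeneous_poisson_process M lam \<Phi> \<longleftrightarrow>
     (\<forall>B \<in> sets borel. (\<lambda>\<omega>. num_points (\<Phi> \<omega>) B) \<in> borel_measurable M) \<and>
     (\<forall>B \<in> sets borel. emeasure lborel B < \<infinity> \<longrightarrow>
        (\<forall>n::nat. measure M {\<omega> \<in> space M. num_points (\<Phi> \<omega>) B = of_nat n}
            = pmf (poisson_pmf (lam * measure lborel B)) n)) \<and>
     (\<forall>(n::nat) (B :: nat \<Rightarrow> real set).
        (\<forall>j<n. B j \<in> sets borel) \<and> disjoint_family_on B {..<n} \<longrightarrow>
        prob_space.indep_vars M (\<lambda>_. borel) (\<lambda>j \<omega>. num_points (\<Phi> \<omega>) (B j)) {..<n})"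

text \<open>Independence of point processes: a process is regarded as the random element
  of the product space given by all of its counts.\<close>

definition indep_point_processes ::
    "'w measure \<Rightarrow> ('i \<Rightarrow> 'w \<Rightarrow> real set) \<Rightarrow> bool" where
  "indep_point_processes M \<Phi> \<longleftrightarrow>
     prob_space.indep_vars M (\<lambda>_. PiM (sets borel) (\<lambda>_. borel))
       (\<lambda>k \<omega>. \<lambda>B \<in> sets borel. num_points (\<Phi> k \<omega>) B) UNIV"

text \<open>The marks are attached to the points through measurable enumerations \<open>x k\<close> of the
  processes \<open>\<Phi> k\<close>; the point \<open>x k i\<close> carries the mark \<open>h k i\<close>. (A homogeneous Poisson
  process on the line with positive intensity has almost surely infinitely many points.) The marks
  must be independent of the enumerated points: independence of the unordered sets alone would
  allow the enumeration to be chosen depending on the marks.\<close>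

definition independent_marking ::
    "'w measure \<Rightarrow> (nat \<Rightarrow> 'w \<Rightarrow> real set) \<Rightarrow> (nat \<Rightarrow> nat \<Rightarrow> 'w \<Rightarrow> real) \<Rightarrow>
     (nat \<Rightarrow> nat \<Rightarrow> 'w \<Rightarrow> real) \<Rightarrow> bool" where
  "independent_marking M \<Phi> x h \<longleftrightarrow>
     (\<forall>k. AE \<omega> in M. bij_betw (\<lambda>i. x k i \<omega>) UNIV (\<Phi> k \<omega>)) \<and>
     prob_space.indep_vars M (\<lambda>_. borel) (\<lambda>(k, i). h k i) UNIV \<and>
     prob_space.indep_var M
       (PiM UNIV (\<lambda>_. borel)) (\<lambda>\<omega> (k, i). h k i \<omega>)
       (PiM UNIV (\<lambda>_. borel)) (\<lambda>\<omega> (k, i). x k i \<omega>)"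

text \<open>Singular path loss \<open>C |x1|\<^sup>-\<^sup>2 x2\<^sup>-\<^sup>\<alpha>\<close>, with value \<open>\<infinity>\<close> at \<open>x1 = 0\<close>
  (the inverse of \<open>0\<close> is \<open>\<infinity>\<close> in \<^typ>\<open>ennreal\<close>).\<close>

definition path_loss :: "real \<Rightarrow> real \<Rightarrow> real \<Rightarrow> real \<Rightarrow> ennreal" where
  "path_loss C \<alpha> x1 x2 = ennreal C * inverse (ennreal (\<bar>x1\<bar> ^ 2)) * ennreal (x2 powr (- \<alpha>))"

definition street_coord :: "real \<Rightarrow> nat \<Rightarrow> real" where
  "street_coord D k = (if k = 0 then 1 else real k * D)"

definition interference ::
    "real \<Rightarrow> real \<Rightarrow> real \<Rightarrow> real \<Rightarrow> (nat \<Rightarrow> nat \<Rightarrow> 'w \<Rightarrow> real) \<Rightarrow>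
     (nat \<Rightarrow> nat \<Rightarrow> 'w \<Rightarrow> real) \<Rightarrow> 'w \<Rightarrow> ennreal" where
  "interference Pt C D \<alpha> x h \<omega> =
     (\<Sum>k. \<Sum>i. ennreal Pt * ennreal (h k i \<omega>) * path_loss C \<alpha> (x k i \<omega>) (street_coord D k))"

definition exp_minus :: "ennreal \<Rightarrow> real" where
  "exp_minus y = (if y = \<infinity> then 0 else exp (- enn2real y))"

definition laplace_transform :: "'w measure \<Rightarrow> ('w \<Rightarrow> ennreal) \<Rightarrow> real \<Rightarrow> real" where
  "laplace_transform M Y s = prob_space.expectation M (\<lambda>\<omega>. exp_minus (ennreal s * Y \<omega>))"

text \<open>The Riemann zeta function on the half-line \<open>s > 1\<close>; it is only used there.\<close>

definition riemann_zeta :: "real \<Rightarrow> real" where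
  "riemann_zeta s = (\<Sum>n. 1 / real (Suc n) powr s)"

end

theory Submission
  imports Defs
begin

text \<open>Conditionally on the points, integrating out the \<open>exp(1)\<close> marks turns \<open>exp (- s I)\<close> into
  the product of \<open>1 / (1 + a k / y\<^sup>2)\<close> over all points \<open>y\<close> of all streets \<open>k\<close>, where
  \<open>a k = s z (street_coord D k) powr (- \<alpha>)\<close>. By independence of the streets and the Laplace functional
  of a Poisson process, the expectation of this product is the product over \<open>k\<close> of
  \<open>exp (- \<lambda> \<integral> a k / (a k + y\<^sup>2) dy) = exp (- \<lambda> \<pi> sqrt (a k))\<close>, and \<open>\<zeta> (\<alpha> / 2)\<close> arises from summing
  \<open>sqrt (a k)\<close>. The Laplace functional is computed for simple functions of bounded support, where it
  is a finite product over disjoint level sets, and extended by monotone approximation.\<close>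

section \<open>The function \<open>exp (- y)\<close> on the extended half-line\<close>

lemma exp_minus_0 [simp]: "exp_minus 0 = 1"
  by (simp add: exp_minus_def)

lemma exp_minus_top [simp]: "exp_minus \<top> = 0"
  by (simp add: exp_minus_def)

lemma exp_minus_ennreal: "0 \<le> a \<Longrightarrow> exp_minus (ennreal a) = exp (- a)"
  by (simp add: exp_minus_def)

lemma exp_minus_nonneg [simp]: "0 \<le> exp_minus y"
  by (simp add: exp_minus_def)

lemma exp_minus_le_1 [simp]: "exp_minus y \<le> 1"
  by (simp add: exp_minus_def)

lemma measurable_exp_minus [measurable]: "exp_minus \<in> borel_measurable borel"
  unfolding exp_minus_def[abs_def] by measurable

lemma exp_minus_add: "exp_minus (a + b) = exp_minus a * exp_minus b"
  by (cases a; cases b) (auto simp: exp_minus_ennreal mult_exp_exp simp flip: ennreal_plus)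

lemma exp_minus_sum: "exp_minus (\<Sum>i\<in>A. f i) = (\<Prod>i\<in>A. exp_minus (f i))"
  by (induction A rule: infinite_finite_induct) (auto simp: exp_minus_add)

lemma exp_minus_antimono: "a \<le> b \<Longrightarrow> exp_minus b \<le> exp_minus a"
  by (cases a; cases b) (auto simp: exp_minus_ennreal top_unique)

text \<open>\<open>enn2real\<close> is continuous only at finite points, so the limit
  \<open>\<top>\<close> needs its own argument: there the values of \<open>f\<close> eventually
  exceed every finite threshold.\<close>

lemma tendsto_exp_minus:
  assumes "(f \<longlongrightarrow> y) F"
  shows "((\<lambda>n. exp_minus (f n)) \<longlongrightarrow> exp_minus y) F"
proof (cases y)
  case (real r)
  have "eventually (\<lambda>n. f n < \<top>) F"
    using assms real by (intro order_tendstoD) auto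
  then have ev: "eventually (\<lambda>n. exp (- enn2real (f n)) = exp_minus (f n)) F"
    by eventually_elim (auto simp: exp_minus_def)
  have "((\<lambda>n. exp (- enn2real (f n))) \<longlongrightarrow> exp (- enn2real y)) F"
    using real assms by (auto intro!: tendsto_intros)
  then show ?thesis
    using tendsto_cong[OF ev] real by (auto simp: exp_minus_def)
next
  case top
  have "eventually (\<lambda>n. exp_minus (f n) < e) F" if "0 < e" for e
  proof -
    \<comment> \<open>Any threshold above \<open>- ln e\<close> pushes \<open>exp_minus\<close>
      below \<open>e\<close>; the slack \<open>1\<close> makes this strict, and \<open>max 0\<close>
      keeps the threshold in the range where \<open>ennreal\<close> does not truncate.\<close>
    have "eventually (\<lambda>n. ennreal (max 0 (1 - ln e)) < f n) F"
      using assms top by (intro order_tendstoD) auto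
    then show ?thesis
    proof eventually_elim
      case (elim n)
      have "exp_minus (f n) \<le> exp_minus (ennreal (max 0 (1 - ln e)))"
        using elim by (intro exp_minus_antimono) auto
      also have "\<dots> = exp (- max 0 (1 - ln e))"
        by (rule exp_minus_ennreal) simp
      also have "\<dots> \<le> exp (ln e - 1)"
        by simp
      also have "\<dots> < exp (ln e)"
        unfolding exp_less_cancel_iff by simp
      finally show ?case
        using that by simp
    qed
  qed
  moreover have "eventually (\<lambda>n. e < exp_minus (f n)) F" if "e < 0" for e
    using that by (auto intro!: always_eventually intro: less_le_trans)
  ultimately show ?thesis
    using top by (auto intro!: order_tendstoI)
qed

lemma exp_minus_SUP_LIMSEQ:
  assumes "incseq f"
  shows "(\<lambda>n. exp_minus (f n)) \<longlonglongrightarrow> exp_minus (SUP n. f n)"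
  using assms by (intro tendsto_exp_minus LIMSEQ_SUP) auto

section \<open>Expectations of \<open>exp_minus\<close>: monotone limits, independent sums, Poisson
  variables\<close>

lemma (in prob_space) integrable_exp_minus:
  assumes [measurable]: "Y \<in> borel_measurable M"
  shows "integrable M (\<lambda>\<omega>. exp_minus (Y \<omega>))"
  by (rule integrable_const_bound[where B = 1]) auto

lemma (in prob_space) expectation_exp_minus_SUP_LIMSEQ:
  assumes [measurable]: "\<And>n. Y n \<in> borel_measurable M"
    and "AE \<omega> in M. incseq (\<lambda>n. Y n \<omega>)"
  shows "(\<lambda>n. expectation (\<lambda>\<omega>. exp_minus (Y n \<omega>)))
    \<longlonglongrightarrow> expectation (\<lambda>\<omega>. exp_minus (SUP n. Y n \<omega>))"
proof (rule integral_dominated_convergence[where w = "\<lambda>_. 1"])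
  show "AE \<omega> in M. (\<lambda>n. exp_minus (Y n \<omega>)) \<longlonglongrightarrow> exp_minus (SUP n. Y n \<omega>)"
    using assms(2) by eventually_elim (rule exp_minus_SUP_LIMSEQ)
qed auto

text \<open>Finite partial sums factor by independence, and both sides pass to the supremum. Writing
  each factor as \<open>exp_minus (L i)\<close> turns the infinite product into a series. The
  injection \<open>e\<close> lets the lemma serve both marks indexed by pairs and streets indexed by
  \<open>nat\<close>.\<close>

lemma (in prob_space) expectation_exp_minus_suminf_indep:
  fixes Y :: "'i \<Rightarrow> 'a \<Rightarrow> ennreal" and e :: "nat \<Rightarrow> 'i"
  assumes indep: "indep_vars (\<lambda>_. borel) Y UNIV" and e: "inj e"
    and E: "\<And>i. expectation (\<lambda>\<omega>. exp_minus (Y i \<omega>)) = exp_minus (L i)"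
  shows "expectation (\<lambda>\<omega>. exp_minus (\<Sum>n. Y (e n) \<omega>)) = exp_minus (\<Sum>n. L (e n))"
proof (rule LIMSEQ_unique)
  have [measurable]: "Y i \<in> borel_measurable M" for i
    using indep by (auto simp: indep_vars_def)
  have inc: "incseq (\<lambda>N. \<Sum>n<N. g n)" for g :: "nat \<Rightarrow> ennreal"
    by (intro incseq_sumI) auto
  show "(\<lambda>N. expectation (\<lambda>\<omega>. exp_minus (\<Sum>n<N. Y (e n) \<omega>)))
      \<longlonglongrightarrow> expectation (\<lambda>\<omega>. exp_minus (\<Sum>n. Y (e n) \<omega>))"
    unfolding suminf_eq_SUP by (rule expectation_exp_minus_SUP_LIMSEQ) (auto intro: inc)
  have "expectation (\<lambda>\<omega>. exp_minus (\<Sum>n<N. Y (e n) \<omega>)) = exp_minus (\<Sum>n<N. L (e n))" for N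
  proof -
    have reindex: "(\<Sum>n<N. g (e n)) = (\<Sum>i\<in>e ` {..<N}. g i)" for g :: "'i \<Rightarrow> ennreal"
      using e by (subst sum.reindex) (auto intro: inj_on_subset)
    have "indep_vars (\<lambda>_. borel) (\<lambda>i \<omega>. exp_minus (Y i \<omega>)) (e ` {..<N})"
      by (rule indep_vars_compose2[OF indep_vars_subset[OF indep]]) auto
    then have "expectation (\<lambda>\<omega>. \<Prod>i\<in>e ` {..<N}. exp_minus (Y i \<omega>))
        = (\<Prod>i\<in>e ` {..<N}. expectation (\<lambda>\<omega>. exp_minus (Y i \<omega>)))"
      by (intro indep_vars_lebesgue_integral integrable_exp_minus) auto
    then show ?thesis
      unfolding reindex[of L] reindex[of "\<lambda>i. Y i _"] by (simp add: exp_minus_sum E)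
  qed
  then show "(\<lambda>N. expectation (\<lambda>\<omega>. exp_minus (\<Sum>n<N. Y (e n) \<omega>))) \<longlonglongrightarrow> exp_minus (\<Sum>n. L (e n))"
    unfolding suminf_eq_SUP by (simp add: exp_minus_SUP_LIMSEQ[OF inc])
qed

text \<open>The Poisson generating function at \<open>exp (- t)\<close>. Only the atoms of the
  \<open>ennreal\<close>-valued \<open>N\<close> are given, so it must first be shown that
  \<open>N\<close> is almost surely a finite integer.\<close>

lemma (in prob_space) expectation_exp_minus_poisson:
  fixes N :: "'a \<Rightarrow> ennreal"
  assumes N [measurable]: "N \<in> borel_measurable M" and "0 \<le> \<mu>" and t: "0 \<le> t"
    and P: "\<And>n::nat. prob {\<omega> \<in> space M. N \<omega> = of_nat n} = \<mu> ^ n / fact n * exp (- \<mu>)"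
  shows "expectation (\<lambda>\<omega>. exp_minus (ennreal t * N \<omega>)) = exp (- (\<mu> * (1 - exp (- t))))"
proof -
  define q where "q n = \<mu> ^ n / fact n * exp (- \<mu>)" for n
  have q_nonneg: "0 \<le> q n" for n
    using \<open>0 \<le> \<mu>\<close> by (simp add: q_def)
  have q_sums: "(\<lambda>n. q n * r ^ n) sums (exp (\<mu> * r) * exp (- \<mu>))" for r
  proof -
    have "(\<lambda>n. (\<mu> * r) ^ n /\<^sub>R fact n * exp (- \<mu>)) sums (exp (\<mu> * r) * exp (- \<mu>))"
      by (intro sums_mult2 exp_converges)
    then show ?thesis
      by (simp add: q_def power_mult_distrib field_simps)
  qed
  have "(\<lambda>n. prob {\<omega> \<in> space M. N \<omega> = of_nat n}) sums
      prob (\<Union>n. {\<omega> \<in> space M. N \<omega> = of_nat n})"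
    by (intro finite_measure_UNION) (auto simp: disjoint_family_on_def)
  \<comment> \<open>The given atoms already carry total mass 1, which rules out the value
    \<open>\<infinity>\<close> and all non-integers up to a null set.\<close>
  with q_sums[of 1] have "prob (\<Union>n. {\<omega> \<in> space M. N \<omega> = of_nat n}) = 1"
    by (simp add: P q_def mult_exp_exp sums_unique2)
  then have "AE \<omega> in M. \<omega> \<in> (\<Union>n. {\<omega> \<in> space M. N \<omega> = of_nat n})"
    by (rule AE_prob_1)
  then have AE_N: "AE \<omega> in M. \<exists>n::nat. N \<omega> = of_nat n"
    by eventually_elim auto
  \<comment> \<open>An everywhere integer-valued version of \<open>N\<close>, whose law can be
    compared with \<open>q\<close> atom by atom.\<close>
  define K where "K \<omega> = nat \<lfloor>enn2real (N \<omega>)\<rfloor>" for \<omega>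
  have [measurable]: "K \<in> measurable M (count_space UNIV)"
    unfolding K_def by measurable
  have NK: "AE \<omega> in M. N \<omega> = of_nat (K \<omega>)"
    using AE_N by eventually_elim (auto simp: K_def)
  have distr_K: "distr M (count_space UNIV) K = density (count_space UNIV) q"
  proof (rule measure_eqI_countable[of _ UNIV])
    fix n :: nat
    have "emeasure M (K -` {n} \<inter> space M) = emeasure M {\<omega> \<in> space M. N \<omega> = of_nat n}"
      using NK by (intro emeasure_eq_AE) auto
    then show "emeasure (distr M (count_space UNIV) K) {n} = emeasure (density (count_space UNIV) q) {n}"
      by (simp add: emeasure_distr emeasure_density P emeasure_eq_measure q_def)
  qed auto
  \<comment> \<open>Integrability is inherited from the bound
    \<open>exp (- t) ^ K \<omega> \<le> 1\<close>; it allows the integral over \<open>nat\<close> to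
    be read as a series below.\<close>
  have int: "integrable (count_space UNIV) (\<lambda>n. q n * exp (- t) ^ n)"
  proof -
    have "integrable M (\<lambda>\<omega>. exp (- t) ^ K \<omega>)"
      using t by (intro integrable_const_bound[where B = 1]) (auto intro!: power_le_one)
    then have "integrable (distr M (count_space UNIV) K) (\<lambda>n. exp (- t) ^ n)"
      by (subst integrable_distr_eq) auto
    then show ?thesis
      unfolding distr_K by (subst (asm) integrable_density) (auto simp: q_nonneg)
  qed
  have "expectation (\<lambda>\<omega>. exp_minus (ennreal t * N \<omega>)) = expectation (\<lambda>\<omega>. exp (- t) ^ K \<omega>)"
  proof (rule integral_cong_AE)
    show "AE \<omega> in M. exp_minus (ennreal t * N \<omega>) = exp (- t) ^ K \<omega>"
      using NK
    proof eventually_elim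
      case (elim \<omega>)
      have "ennreal t * N \<omega> = ennreal (t * real (K \<omega>))"
        using t by (simp add: elim ennreal_mult ennreal_of_nat_eq_real_of_nat)
      then show ?case
        using t by (simp add: exp_minus_ennreal mult.commute flip: exp_of_nat_mult)
    qed
  qed auto
  also have "\<dots> = (\<integral>n. exp (- t) ^ n \<partial>distr M (count_space UNIV) K)"
    by (subst integral_distr) auto
  also have "\<dots> = (\<integral>n. q n * exp (- t) ^ n \<partial>count_space UNIV)"
    unfolding distr_K by (subst integral_density) (auto simp: q_nonneg)
  also have "\<dots> = exp (\<mu> * exp (- t)) * exp (- \<mu>)"
    using sums_integral_count_space_nat[OF int] q_sums[of "exp (- t)"] by (rule sums_unique2)
  finally show ?thesis
    by (simp add: mult_exp_exp algebra_simps)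
qed

section \<open>Rayleigh fading\<close>

text \<open>Chosen so that \<open>exp (- fading_exponent c) = 1 / (1 + c)\<close>, the Laplace transform of an
  \<open>exp(1)\<close> mark at \<open>c\<close>; it is \<open>\<infinity>\<close> at \<open>c = \<infinity>\<close>, i.e. for a point at the origin.\<close>

definition fading_exponent :: "ennreal \<Rightarrow> ennreal" where
  "fading_exponent c = (if c = \<top> then \<top> else ennreal (ln (1 + enn2real c)))"

lemma measurable_fading_exponent [measurable]: "fading_exponent \<in> borel_measurable borel"
  unfolding fading_exponent_def[abs_def] by measurable

lemma exp_minus_fading_exponent:
  "exp_minus (fading_exponent c) = (if c = \<top> then 0 else 1 / (1 + enn2real c))"
  by (simp add: fading_exponent_def exp_minus_ennreal exp_minus inverse_eq_divide add_pos_nonneg)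

text \<open>For finite \<open>c = r\<close>, exponential tilting: the rate-1 density times
  \<open>exp (- r * x)\<close> is the density of rate \<open>1 + r\<close> divided by
  \<open>1 + r\<close>, and that density has mass 1. For \<open>c = \<top>\<close> the mark is
  almost surely positive, so the exponent is infinite.\<close>

lemma (in prob_space) expectation_exp_minus_exponential:
  assumes D: "distributed M lborel X (exponential_density 1)"
  shows "expectation (\<lambda>\<omega>. exp_minus (c * ennreal (X \<omega>))) = exp_minus (fading_exponent c)"
proof (cases c)
  case top
  have [measurable]: "X \<in> borel_measurable M"
    using distributed_measurable[OF D] by simp
  have "prob {\<omega> \<in> space M. 0 < X \<omega>} = 1"
    using exponential_distributedD_gt[OF D, of 0] by simp
  then have "AE \<omega> in M. 0 < X \<omega>"
    by (subst (asm) prob_Collect_eq_1) auto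
  then have "AE \<omega> in M. exp_minus (c * ennreal (X \<omega>)) = 0"
    by eventually_elim (simp add: top ennreal_top_mult)
  then show ?thesis
    by (simp add: exp_minus_fading_exponent top integral_eq_zero_AE)
next
  case (real r)
  have "(\<integral>\<^sup>+x. ennreal (exponential_density (1 + r) x) \<partial>lborel) = 1"
    using prob_space.emeasure_space_1[OF prob_space_exponential_density[of "1 + r"]] real
    by (simp add: emeasure_density)
  then have I: "(\<integral>x. exponential_density (1 + r) x \<partial>lborel) = 1"
    using real by (subst integral_eq_nn_integral) (auto intro!: AE_I2 exponential_density_nonneg)
  have "expectation (\<lambda>\<omega>. exp_minus (c * ennreal (X \<omega>)))
      = (\<integral>x. exponential_density 1 x * exp_minus (c * ennreal x) \<partial>lborel)"
    by (rule distributed_integral[OF D, symmetric]) (auto intro!: exponential_density_nonneg)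
  also have "\<dots> = (\<integral>x. exponential_density (1 + r) x / (1 + r) \<partial>lborel)"
  proof (rule Bochner_Integration.integral_cong)
    fix x :: real
    have "exponential_density (1 + r) x / (1 + r) = (if x < 0 then 0 else exp (- x * (1 + r)))"
      using real by (simp add: exponential_density_def)
    then show "exponential_density 1 x * exp_minus (c * ennreal x) = exponential_density (1 + r) x / (1 + r)"
      using real by (cases "x < 0")
        (auto simp: exponential_density_def exp_minus_ennreal mult_exp_exp algebra_simps simp flip: ennreal_mult)
  qed simp
  also have "\<dots> = 1 / (1 + r)"
    using I by simp
  finally show ?thesis
    using real by (simp add: exp_minus_fading_exponent)
qed

lemma nn_integral_fading_exponent_inverse_square:
  assumes "0 < a"
  shows "(\<integral>\<^sup>+x. ennreal (1 - exp_minus (fading_exponent (ennreal a * inverse (ennreal (x ^ 2))))) \<partial>lborel)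
    = ennreal (pi * sqrt a)"
proof -
  have int: "integrable lborel (\<lambda>x::real. inverse (1 + x ^ 2))"
    and I: "(\<integral>x. inverse (1 + x ^ 2) \<partial>(lborel :: real measure)) = pi"
    using integrable_inverse_1_plus_square LBINT_inverse_1_plus_square
    by (simp_all add: set_integrable_def interval_lebesgue_integral_def set_lebesgue_integral_def)
  \<comment> \<open>This holds at \<open>x = 0\<close> too: the argument of
    \<open>fading_exponent\<close> is \<open>\<top>\<close> there, and both sides are 1.\<close>
  have "1 - exp_minus (fading_exponent (ennreal a * inverse (ennreal (x ^ 2)))) = a / (a + x ^ 2)" for x
    using assms
    using add_pos_nonneg[of a "x ^ 2"]
    by (cases "x = 0")
      (auto simp: exp_minus_fading_exponent ennreal_mult_top inverse_ennreal field_simps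
        simp flip: ennreal_mult add_divide_distrib)
  then have "(\<integral>\<^sup>+x. ennreal (1 - exp_minus (fading_exponent (ennreal a * inverse (ennreal (x ^ 2))))) \<partial>lborel)
      = (\<integral>\<^sup>+x. ennreal (a / (a + x ^ 2)) \<partial>lborel)"
    by simp
  \<comment> \<open>Rescaling by \<open>sqrt a\<close> reduces the integral to that of
    \<open>1 / (1 + x ^ 2)\<close>, which is \<open>pi\<close>.\<close>
  also have "\<dots> = ennreal (sqrt a) * (\<integral>\<^sup>+x. ennreal (a / (a + (sqrt a * x) ^ 2)) \<partial>lborel)"
    using assms nn_integral_real_affine[of "\<lambda>x. ennreal (a / (a + x ^ 2))" "sqrt a" 0] by simp
  also have "(\<lambda>x. a / (a + (sqrt a * x) ^ 2)) = (\<lambda>x. inverse (1 + x ^ 2))"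
  proof
    fix x :: real
    have "a + (sqrt a * x) ^ 2 = a * (1 + x ^ 2)"
      using assms by (simp add: power_mult_distrib algebra_simps)
    then show "a / (a + (sqrt a * x) ^ 2) = inverse (1 + x ^ 2)"
      using assms by (simp add: inverse_eq_divide)
  qed
  also have "(\<integral>\<^sup>+x. ennreal (inverse (1 + x ^ 2)) \<partial>(lborel :: real measure)) = ennreal pi"
    using nn_integral_eq_integral[OF int] by (simp add: I)
  finally show ?thesis
    using assms by (simp add: ennreal_mult mult.commute)
qed

section \<open>The Laplace functional of a Poisson process\<close>

lemma nn_integral_count_space_indicator_eq_num_points:
  "(\<integral>\<^sup>+y. indicator B y \<partial>count_space S) = num_points S B"
proof -
  have "(\<integral>\<^sup>+y. indicator B y \<partial>count_space S) = (\<integral>\<^sup>+y. indicator B y * indicator S y \<partial>count_space UNIV)"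
    by (rule nn_integral_count_space_indicator) auto
  also have "\<dots> = (\<integral>\<^sup>+y. indicator (S \<inter> B) y \<partial>count_space UNIV)"
    by (intro nn_integral_cong) (simp split: split_indicator)
  also have "\<dots> = emeasure (count_space UNIV) (S \<inter> B)"
    by (rule nn_integral_indicator) simp
  finally show ?thesis
    unfolding num_points_def .
qed

text \<open>Measurability and independence of the processes are given only through their counts;
  this factorization transfers both to sums over the points. Indicators correspond to coordinate
  projections, and the remaining Borel functions follow by induction. \<open>G\<close> does not
  depend on \<open>S\<close>.\<close>

lemma nn_integral_count_space_factors_through_counts:
  assumes "f \<in> borel_measurable borel"
  obtains G :: "(real set \<Rightarrow> ennreal) \<Rightarrow> ennreal"
  where "G \<in> borel_measurable (PiM (sets borel) (\<lambda>_. borel))"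
    and "\<And>S. (\<integral>\<^sup>+y. f y \<partial>count_space S) = G (\<lambda>B \<in> sets borel. num_points S B)"
proof -
  let ?P = "\<lambda>f G. G \<in> borel_measurable (PiM (sets borel) (\<lambda>_. borel :: ennreal measure)) \<and>
    (\<forall>S. (\<integral>\<^sup>+y. f y \<partial>count_space S) = G (\<lambda>B \<in> sets (borel :: real measure). num_points S B))"
  have "\<exists>G. ?P f G"
    using assms
  proof (induction rule: borel_measurable_induct)
    case (cong f g)
    then show ?case
      by (metis space_borel UNIV_I ext)
  next
    case (set A)
    then have "?P (indicator A) (\<lambda>c. c A)"
      by (auto simp: nn_integral_count_space_indicator_eq_num_points intro!: measurable_component_singleton)
    then show ?case
      by blast
  next
    case (mult u c)
    then obtain G where "?P u G" by blast
    then have "?P (\<lambda>x. c * u x) (\<lambda>k. c * G k)"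
      by (auto simp: nn_integral_cmult)
    then show ?case
      by blast
  next
    case (add u v)
    then obtain G H where "?P u G" "?P v H" by blast
    then have "?P (\<lambda>x. v x + u x) (\<lambda>k. H k + G k)"
      by (auto simp: nn_integral_add)
    then show ?case
      by blast
  next
    case (seq U)
    then obtain G where G: "\<And>i. ?P (U i) (G i)" by metis
    have "?P (SUP i. U i) (\<lambda>k. SUP i. G i k)"
    proof (intro conjI allI)
      show "(\<lambda>k. SUP i. G i k) \<in> borel_measurable (PiM (sets borel) (\<lambda>_. borel))"
        using G by (intro borel_measurable_SUP) auto
      fix S
      have "(\<integral>\<^sup>+y. (SUP i. U i y) \<partial>count_space S) = (SUP i. \<integral>\<^sup>+y. U i y \<partial>count_space S)"
        using seq by (intro nn_integral_monotone_convergence_SUP) auto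
      then show "(\<integral>\<^sup>+y. (SUP i. U i) y \<partial>count_space S) = (SUP i. G i (\<lambda>B \<in> sets borel. num_points S B))"
        using G by (simp add: image_comp)
    qed
    then show ?case
      by blast
  qed
  then show thesis
    using that by blast
qed

lemma measurable_nn_integral_point_process:
  assumes \<Phi>: "\<And>B. B \<in> sets borel \<Longrightarrow> (\<lambda>\<omega>. num_points (\<Phi> \<omega>) B) \<in> borel_measurable M"
    and f: "f \<in> borel_measurable borel"
  shows "(\<lambda>\<omega>. \<integral>\<^sup>+y. f y \<partial>count_space (\<Phi> \<omega>)) \<in> borel_measurable M"
proof -
  obtain G where [measurable]: "G \<in> borel_measurable (PiM (sets borel) (\<lambda>_. borel))"
    and G: "\<And>S. (\<integral>\<^sup>+y. f y \<partial>count_space S) = G (\<lambda>B \<in> sets borel. num_points S B)"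
    using nn_integral_count_space_factors_through_counts[OF f] by blast
  have [measurable]: "(\<lambda>\<omega>. \<lambda>B \<in> sets borel. num_points (\<Phi> \<omega>) B) \<in> measurable M (PiM (sets borel) (\<lambda>_. borel))"
    using \<Phi> by (intro measurable_restrict)
  show ?thesis
    unfolding G by measurable
qed

section \<open>The Laplace functional, from step functions to Borel functions\<close>

lemma sum_indicator_disjoint_family:
  fixes w :: "'i \<Rightarrow> 'b::semiring_1"
  assumes "disjoint_family_on B I" "finite I" "i \<in> I" "y \<in> B i"
  shows "(\<Sum>j\<in>I. w j * indicator (B j) y) = w i"
proof -
  have "(\<Sum>j\<in>I. w j * indicator (B j) y) = (\<Sum>j\<in>I. if j = i then w j else 0)"
    using assms by (intro sum.cong) (auto simp: disjoint_family_on_def split: split_indicator)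
  then show ?thesis
    using assms by simp
qed

lemma (in prob_space) homogeneous_poisson_process_prob_num_points:
  assumes \<Phi>: "homogeneous_poisson_process M lam \<Phi>" and "0 < lam"
    and B: "B \<in> sets borel" "emeasure lborel B < \<infinity>"
  shows "prob {\<omega> \<in> space M. num_points (\<Phi> \<omega>) B = of_nat n}
    = (lam * measure lborel B) ^ n / fact n * exp (- (lam * measure lborel B))"
proof -
  have P: "prob {\<omega> \<in> space M. num_points (\<Phi> \<omega>) A = of_nat n} = pmf (poisson_pmf (lam * measure lborel A)) n"
    if "A \<in> sets borel" "emeasure lborel A < \<infinity>" for A
    using \<Phi> that by (simp add: homogeneous_poisson_process_def)
  show ?thesis
  proof (cases "measure lborel B = 0")
    case True
    text \<open>\<^const>\<open>poisson_pmf\<close> is specified only for positive rates; its value at rate \<open>0\<close> is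
      read off from the empty set.\<close>
    have "pmf (poisson_pmf 0) n = prob {\<omega> \<in> space M. n = 0}"
      using P[of "{}"] by (simp add: num_points_def eq_commute[of 0])
    then show ?thesis
      using P[OF B] True by (cases n) (auto simp: prob_space)
  next
    case False
    then have "0 < lam * measure lborel B"
      using \<open>0 < lam\<close> by (simp add: less_le)
    then show ?thesis
      using P[OF B] by simp
  qed
qed

text \<open>For a step function the sum over the points is a linear combination of the counts of the
  disjoint sets \<open>B j\<close>. These counts are independent and Poisson, so the expectation is
  a finite product.\<close>

lemma (in prob_space) laplace_functional_poisson_simple:
  fixes n :: nat
  assumes \<Phi>: "homogeneous_poisson_process M lam \<Phi>" and lam: "0 < lam"
    and B: "\<And>j. j < n \<Longrightarrow> B j \<in> sets borel" "\<And>j. j < n \<Longrightarrow> emeasure lborel (B j) < \<infinity>"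
    and disj: "disjoint_family_on B {..<n}" and v: "\<And>j. j < n \<Longrightarrow> 0 \<le> v j"
    and g: "\<And>y. g y = (\<Sum>j<n. ennreal (v j) * indicator (B j) y)"
  shows "expectation (\<lambda>\<omega>. exp_minus (\<integral>\<^sup>+y. g y \<partial>count_space (\<Phi> \<omega>)))
    = exp_minus (ennreal lam * (\<integral>\<^sup>+y. ennreal (1 - exp_minus (g y)) \<partial>lborel))"
proof -
  have N: "(\<lambda>\<omega>. num_points (\<Phi> \<omega>) A) \<in> borel_measurable M" if "A \<in> sets borel" for A
    using \<Phi> that by (auto simp: homogeneous_poisson_process_def)
  have "indep_vars (\<lambda>_. borel) (\<lambda>j \<omega>. num_points (\<Phi> \<omega>) (B j)) {..<n}"
    using \<Phi>[unfolded homogeneous_poisson_process_def, THEN conjunct2, THEN conjunct2,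
      THEN spec[of _ n], THEN spec[of _ B], THEN mp] B(1) disj by simp
  then have indep: "indep_vars (\<lambda>_. borel) (\<lambda>j \<omega>. exp_minus (ennreal (v j) * num_points (\<Phi> \<omega>) (B j))) {..<n}"
    by (rule indep_vars_compose2) auto
  have "(\<integral>\<^sup>+y. g y \<partial>count_space S) = (\<Sum>j<n. ennreal (v j) * num_points S (B j))" for S
  proof -
    have "(\<integral>\<^sup>+y. g y \<partial>count_space S) = (\<Sum>j<n. \<integral>\<^sup>+y. ennreal (v j) * indicator (B j) y \<partial>count_space S)"
      unfolding g by (rule nn_integral_sum) simp
    then show ?thesis
      by (simp add: nn_integral_cmult nn_integral_count_space_indicator_eq_num_points)
  qed
  then have "expectation (\<lambda>\<omega>. exp_minus (\<integral>\<^sup>+y. g y \<partial>count_space (\<Phi> \<omega>)))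
      = expectation (\<lambda>\<omega>. \<Prod>j<n. exp_minus (ennreal (v j) * num_points (\<Phi> \<omega>) (B j)))"
    by (simp add: exp_minus_sum)
  also have "\<dots> = (\<Prod>j<n. expectation (\<lambda>\<omega>. exp_minus (ennreal (v j) * num_points (\<Phi> \<omega>) (B j))))"
    using B N by (intro indep_vars_lebesgue_integral[OF _ indep] integrable_exp_minus) auto
  also have "\<dots> = (\<Prod>j<n. exp (- (lam * measure lborel (B j) * (1 - exp (- v j)))))"
    using B lam v N
    by (intro prod.cong refl expectation_exp_minus_poisson homogeneous_poisson_process_prob_num_points[OF \<Phi>])
      auto
  also have "\<dots> = exp_minus (\<Sum>j<n. ennreal (lam * measure lborel (B j) * (1 - exp (- v j))))"
    using lam v by (simp add: exp_minus_sum exp_minus_ennreal)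
  also have "(\<Sum>j<n. ennreal (lam * measure lborel (B j) * (1 - exp (- v j))))
      = ennreal lam * (\<Sum>j<n. ennreal (1 - exp (- v j)) * emeasure lborel (B j))"
    unfolding sum_distrib_left
  proof (intro sum.cong refl)
    fix j assume "j \<in> {..<n}"
    then show "ennreal (lam * measure lborel (B j) * (1 - exp (- v j)))
        = ennreal lam * (ennreal (1 - exp (- v j)) * emeasure lborel (B j))"
      using B[of j] v[of j] lam
      by (simp add: emeasure_eq_ennreal_measure ennreal_mult mult_ac less_top)
  qed
  also have "(\<Sum>j<n. ennreal (1 - exp (- v j)) * emeasure lborel (B j))
      = (\<integral>\<^sup>+y. (\<Sum>j<n. ennreal (1 - exp (- v j)) * indicator (B j) y) \<partial>lborel)"
    using B by (subst nn_integral_sum) (auto simp: nn_integral_cmult)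
  \<comment> \<open>At most one \<open>B j\<close> contains a given \<open>y\<close>, so applying
    \<open>1 - exp_minus\<close> to the step function \<open>g\<close> acts on its coefficients;
    outside all \<open>B j\<close> both sides vanish.\<close>
  also have "\<dots> = (\<integral>\<^sup>+y. ennreal (1 - exp_minus (g y)) \<partial>lborel)"
  proof (intro nn_integral_cong)
    fix y :: real
    show "(\<Sum>j<n. ennreal (1 - exp (- v j)) * indicator (B j) y) = ennreal (1 - exp_minus (g y))"
    proof (cases "\<exists>i<n. y \<in> B i")
      case True
      then obtain i where i: "i < n" "y \<in> B i" by blast
      have *: "(\<Sum>j<n. w j * indicator (B j) y) = w i" for w :: "nat \<Rightarrow> ennreal"
        using i by (intro sum_indicator_disjoint_family[OF disj]) auto
      show ?thesis
        using v i by (simp add: g * exp_minus_ennreal)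
    next
      case False
      then have *: "(\<Sum>j<n. w j * indicator (B j) y) = 0" for w :: "nat \<Rightarrow> ennreal"
        by (intro sum.neutral) auto
      show ?thesis
        by (simp add: g *)
    qed
  qed
  finally show ?thesis .
qed

theorem (in prob_space) laplace_functional_poisson:
  assumes \<Phi>: "homogeneous_poisson_process M lam \<Phi>" and lam: "0 < lam"
    and f: "f \<in> borel_measurable borel"
  shows "expectation (\<lambda>\<omega>. exp_minus (\<integral>\<^sup>+y. f y \<partial>count_space (\<Phi> \<omega>)))
    = exp_minus (ennreal lam * (\<integral>\<^sup>+y. ennreal (1 - exp_minus (f y)) \<partial>lborel))"
proof -
  have N: "(\<lambda>\<omega>. num_points (\<Phi> \<omega>) A) \<in> borel_measurable M" if "A \<in> sets borel" for A
    using \<Phi> that by (auto simp: homogeneous_poisson_process_def)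
  obtain F where F: "\<And>i. simple_function borel (F i)" "incseq F" "\<And>i x. F i x < \<top>" "\<And>x. (SUP i. F i x) = f x"
    using borel_measurable_implies_simple_function_sequence'[OF f] by blast
  \<comment> \<open>Truncating to a bounded interval gives the nonzero level sets finite Lebesgue
    measure, as the Poisson law of the counts requires.\<close>
  define g where "g i y = F i y * indicator {- real i..real i} y" for i :: nat and y
  have g_meas [measurable]: "g i \<in> borel_measurable borel" for i
    using borel_measurable_simple_function[OF F(1)[of i]] unfolding g_def[abs_def] by measurable
  have g_inc: "incseq g"
    using F(2) by (auto simp: incseq_def le_fun_def g_def intro!: mult_mono split: split_indicator)
  have g_lim: "(\<lambda>i. g i y) \<longlonglongrightarrow> f y" for y
  proof (rule Lim_transform_eventually)
    show "(\<lambda>i. F i y) \<longlonglongrightarrow> f y"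
      using LIMSEQ_SUP[of "\<lambda>i. F i y"] F(2,4) by (simp add: incseq_def le_fun_def)
    have "eventually (\<lambda>i. \<bar>y\<bar> \<le> real i) sequentially"
      by real_asymp
    then show "eventually (\<lambda>i. F i y = g i y) sequentially"
      by eventually_elim (simp add: g_def abs_le_iff)
  qed
  have g_SUP: "(SUP i. g i y) = f y" for y
    using LIMSEQ_unique[OF LIMSEQ_SUP g_lim] g_inc by (simp add: incseq_def le_fun_def)
  have simple: "expectation (\<lambda>\<omega>. exp_minus (\<integral>\<^sup>+y. g i y \<partial>count_space (\<Phi> \<omega>)))
    = exp_minus (ennreal lam * (\<integral>\<^sup>+y. ennreal (1 - exp_minus (g i y)) \<partial>lborel))" for i
  proof -
    have "simple_function borel (g i)"
      unfolding g_def by (intro simple_function_mult F simple_function_indicator) auto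
    \<comment> \<open>The value 0 is left out: its level set has infinite measure and contributes
      nothing to the sum.\<close>
    then have fin: "finite (range (g i) - {0})"
      by (simp add: simple_function_def)
    then obtain e where e: "bij_betw e {0..<card (range (g i) - {0})} (range (g i) - {0})"
      using ex_bij_betw_nat_finite by blast
    define n where "n = card (range (g i) - {0})"
    have bij: "bij_betw e {..<n} (range (g i) - {0})"
      using e by (simp add: n_def atLeast0LessThan)
    define B where "B j = g i -` {e j}" for j
    have disj: "disjoint_family_on B {..<n}"
      using bij by (auto simp: B_def disjoint_family_on_def bij_betw_def inj_on_def)
    have e_range: "e j \<in> range (g i) - {0}" if "j < n" for j
      using bij that by (auto simp: bij_betw_def)
    have g_fin: "g i y < \<top>" for y
      using F(3)[of i y] by (simp add: g_def split: split_indicator)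
    \<comment> \<open>Finiteness of the values matters here, since \<open>enn2real\<close> would
      send \<open>\<top>\<close> to 0.\<close>
    have e_fin: "ennreal (enn2real (e j)) = e j" if "j < n" for j
      using e_range[OF that] g_fin by (auto intro: ennreal_enn2real)
    show ?thesis
    proof (rule laplace_functional_poisson_simple[OF \<Phi> lam, of n B "\<lambda>j. enn2real (e j)"])
      fix j assume j: "j < n"
      show "B j \<in> sets borel"
        using measurable_sets[OF g_meas[of i], of "{e j}"] by (simp add: B_def)
      have "B j \<subseteq> {- real i..real i}"
        using e_range[OF j] by (auto simp: B_def g_def split: split_indicator_asm)
      then have "emeasure lborel (B j) \<le> emeasure lborel {- real i..real i}"
        by (intro emeasure_mono) auto
      then show "emeasure lborel (B j) < \<infinity>"
        by (simp add: le_less_trans)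
      show "0 \<le> enn2real (e j)" by simp
    next
      fix y
      have *: "(\<Sum>j<n. ennreal (enn2real (e j)) * indicator (B j) y) = (\<Sum>j<n. e j * indicator (B j) y)"
        by (intro sum.cong) (auto simp: e_fin)
      show "g i y = (\<Sum>j<n. ennreal (enn2real (e j)) * indicator (B j) y)"
      proof (cases "g i y = 0")
        case True
        then show ?thesis
          unfolding * by (subst sum.neutral) (use e_range in \<open>auto simp: B_def split: split_indicator\<close>)
      next
        case False
        then have "g i y \<in> e ` {..<n}"
          unfolding bij_betw_imp_surj_on[OF bij] by simp
        then obtain k where k: "k < n" "e k = g i y"
          by auto
        then show ?thesis
          unfolding * by (subst sum_indicator_disjoint_family[OF disj, of k]) (auto simp: B_def)
      qed
    qed (rule disj)
  qed
  have mono: "incseq (\<lambda>i. \<integral>\<^sup>+y. g i y \<partial>count_space S)" for S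
    using g_inc by (auto simp: incseq_def le_fun_def intro!: nn_integral_mono)
  have "(\<integral>\<^sup>+y. f y \<partial>count_space S) = (SUP i. \<integral>\<^sup>+y. g i y \<partial>count_space S)" for S
    unfolding g_SUP[symmetric] using g_inc by (intro nn_integral_monotone_convergence_SUP) auto
  then have "(\<lambda>i. expectation (\<lambda>\<omega>. exp_minus (\<integral>\<^sup>+y. g i y \<partial>count_space (\<Phi> \<omega>))))
      \<longlonglongrightarrow> expectation (\<lambda>\<omega>. exp_minus (\<integral>\<^sup>+y. f y \<partial>count_space (\<Phi> \<omega>)))"
    using mono by (auto intro!: expectation_exp_minus_SUP_LIMSEQ measurable_nn_integral_point_process N)
  moreover have "(\<lambda>i. \<integral>\<^sup>+y. ennreal (1 - exp_minus (g i y)) \<partial>lborel)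
      \<longlonglongrightarrow> (\<integral>\<^sup>+y. ennreal (1 - exp_minus (f y)) \<partial>lborel)"
  proof (rule nn_integral_LIMSEQ)
    show "incseq (\<lambda>i y. ennreal (1 - exp_minus (g i y)))"
      using g_inc by (auto simp: incseq_def le_fun_def intro!: ennreal_leI exp_minus_antimono)
    show "(\<lambda>i. ennreal (1 - exp_minus (g i y))) \<longlonglongrightarrow> ennreal (1 - exp_minus (f y))" for y
      by (intro tendsto_ennrealI tendsto_diff tendsto_const tendsto_exp_minus g_lim)
  qed auto
  \<comment> \<open>The limiting integral may be infinite; continuity of \<open>exp_minus\<close> at
    \<open>\<top>\<close> covers that case.\<close>
  then have "(\<lambda>i. exp_minus (ennreal lam * (\<integral>\<^sup>+y. ennreal (1 - exp_minus (g i y)) \<partial>lborel)))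
      \<longlonglongrightarrow> exp_minus (ennreal lam * (\<integral>\<^sup>+y. ennreal (1 - exp_minus (f y)) \<partial>lborel))"
    by (intro tendsto_exp_minus ennreal_tendsto_cmult) auto
  ultimately show ?thesis
    unfolding simple by (rule LIMSEQ_unique)
qed

section \<open>Independent marks and independent streets\<close>

text \<open>Marks and points are independent as whole families, so their joint law is a product
  measure. By Fubini the marks can be integrated out with the points frozen, each mark contributing
  one fading factor.\<close>

lemma (in prob_space) expectation_exp_minus_marks:
  fixes H X :: "nat \<times> nat \<Rightarrow> 'a \<Rightarrow> real"
  assumes H_indep: "indep_vars (\<lambda>_. borel) H UNIV"
    and HX: "indep_var (PiM UNIV (\<lambda>_. borel)) (\<lambda>\<omega> p. H p \<omega>) (PiM UNIV (\<lambda>_. borel)) (\<lambda>\<omega> p. X p \<omega>)"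
    and H_distr: "\<And>p. distributed M lborel (H p) (exponential_density 1)"
    and \<phi> [measurable]: "\<And>p. \<phi> p \<in> borel_measurable borel"
  shows "expectation (\<lambda>\<omega>. exp_minus (\<Sum>k. \<Sum>i. \<phi> (k, i) (X (k, i) \<omega>) * ennreal (H (k, i) \<omega>)))
    = expectation (\<lambda>\<omega>. exp_minus (\<Sum>k. \<Sum>i. fading_exponent (\<phi> (k, i) (X (k, i) \<omega>))))"
proof -
  let ?d = prod_decode
  let ?P = "PiM UNIV (\<lambda>_. borel) :: (nat \<times> nat \<Rightarrow> real) measure"
  \<comment> \<open>Flattening the double sum with \<open>prod_decode\<close> makes it one series of
    independent terms.\<close>
  have double_sum: "(\<Sum>k. \<Sum>i. f (k, i)) = (\<Sum>n. f (?d n))" for f :: "nat \<times> nat \<Rightarrow> ennreal"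
    by (rule suminf_ennreal_2dimen[symmetric]) simp
  have [measurable]: "(\<lambda>\<omega> p. H p \<omega>) \<in> measurable M ?P" "(\<lambda>\<omega> p. X p \<omega>) \<in> measurable M ?P"
    and distr_HX: "distr M ?P (\<lambda>\<omega> p. H p \<omega>) \<Otimes>\<^sub>M distr M ?P (\<lambda>\<omega> p. X p \<omega>)
      = distr M (?P \<Otimes>\<^sub>M ?P) (\<lambda>\<omega>. (\<lambda>p. H p \<omega>, \<lambda>p. X p \<omega>))"
    using HX by (simp_all add: indep_var_distribution_eq)
  interpret PH: prob_space "distr M ?P (\<lambda>\<omega> p. H p \<omega>)"
    by (rule prob_space_distr) measurable
  interpret PX: prob_space "distr M ?P (\<lambda>\<omega> p. X p \<omega>)"
    by (rule prob_space_distr) measurable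
  interpret HX: pair_prob_space "distr M ?P (\<lambda>\<omega> p. H p \<omega>)" "distr M ?P (\<lambda>\<omega> p. X p \<omega>)" ..
  define F where "F u v = exp_minus (\<Sum>n. \<phi> (?d n) (v (?d n)) * ennreal (u (?d n)))"
    for u v :: "nat \<times> nat \<Rightarrow> real"
  have F_meas [measurable]: "(\<lambda>(u, v). F u v) \<in> borel_measurable (?P \<Otimes>\<^sub>M ?P)"
    unfolding F_def by measurable
  have F_meas1 [measurable]: "(\<lambda>u. F u v) \<in> borel_measurable ?P" for v
    unfolding F_def by measurable
  \<comment> \<open>Here \<open>v\<close> is a fixed configuration of points, so only the marks are
    random.\<close>
  have conditional: "expectation (\<lambda>\<omega>. F (\<lambda>p. H p \<omega>) v) = exp_minus (\<Sum>n. fading_exponent (\<phi> (?d n) (v (?d n))))" for v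
    unfolding F_def
  proof (rule expectation_exp_minus_suminf_indep)
    show "indep_vars (\<lambda>_. borel) (\<lambda>p \<omega>. \<phi> p (v p) * ennreal (H p \<omega>)) UNIV"
      using H_indep by (rule indep_vars_compose2) auto
    show "expectation (\<lambda>\<omega>. exp_minus (\<phi> p (v p) * ennreal (H p \<omega>)))
        = exp_minus (fading_exponent (\<phi> p (v p)))" for p
      by (rule expectation_exp_minus_exponential) (rule H_distr)
  qed (rule inj_prod_decode)
  have "expectation (\<lambda>\<omega>. F (\<lambda>p. H p \<omega>) (\<lambda>p. X p \<omega>))
      = (\<integral>(u, v). F u v \<partial>(distr M ?P (\<lambda>\<omega> p. H p \<omega>) \<Otimes>\<^sub>M distr M ?P (\<lambda>\<omega> p. X p \<omega>)))"
    unfolding distr_HX by (subst integral_distr) auto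
  also have "\<dots> = (\<integral>v. (\<integral>u. F u v \<partial>distr M ?P (\<lambda>\<omega> p. H p \<omega>)) \<partial>distr M ?P (\<lambda>\<omega> p. X p \<omega>))"
    by (rule HX.integral_snd[symmetric], rule HX.P.integrable_const_bound[where B = 1])
      (auto simp: F_def)
  also have "\<dots> = (\<integral>v. exp_minus (\<Sum>n. fading_exponent (\<phi> (?d n) (v (?d n)))) \<partial>distr M ?P (\<lambda>\<omega> p. X p \<omega>))"
    by (simp add: integral_distr conditional)
  also have "\<dots> = expectation (\<lambda>\<omega>. exp_minus (\<Sum>n. fading_exponent (\<phi> (?d n) (X (?d n) \<omega>))))"
    by (subst integral_distr) auto
  finally show ?thesis
    unfolding F_def double_sum[of "\<lambda>p. \<phi> p (X p _) * ennreal (H p _)"]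
      double_sum[of "\<lambda>p. fading_exponent (\<phi> p (X p _))"] .
qed

text \<open>The sum over street \<open>k\<close> is a measurable function \<open>G k\<close> of that
  street's counts, so independence of the count families passes to these sums.\<close>

lemma (in prob_space) expectation_exp_minus_suminf_point_processes:
  assumes \<Phi>: "\<And>k::nat. homogeneous_poisson_process M lam (\<Phi> k)" and lam: "0 < lam"
    and indep: "indep_point_processes M \<Phi>"
    and f: "\<And>k. f k \<in> borel_measurable borel"
  shows "expectation (\<lambda>\<omega>. exp_minus (\<Sum>k. \<integral>\<^sup>+y. f k y \<partial>count_space (\<Phi> k \<omega>)))
    = exp_minus (\<Sum>k. ennreal lam * (\<integral>\<^sup>+y. ennreal (1 - exp_minus (f k y)) \<partial>lborel))"
proof (rule expectation_exp_minus_suminf_indep[where e = "\<lambda>k. k"])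
  have "\<exists>G. G \<in> borel_measurable (PiM (sets borel) (\<lambda>_. borel)) \<and>
      (\<forall>S. (\<integral>\<^sup>+y. f k y \<partial>count_space S) = G (\<lambda>B \<in> sets borel. num_points S B))" for k
    using nn_integral_count_space_factors_through_counts[OF f] by blast
  then obtain G where G_meas: "\<And>k. G k \<in> borel_measurable (PiM (sets borel) (\<lambda>_. borel))"
    and G: "\<And>k S. (\<integral>\<^sup>+y. f k y \<partial>count_space S) = G k (\<lambda>B \<in> sets borel. num_points S B)"
    by metis
  show "indep_vars (\<lambda>_. borel) (\<lambda>k \<omega>. \<integral>\<^sup>+y. f k y \<partial>count_space (\<Phi> k \<omega>)) UNIV"
    unfolding G using indep G_meas unfolding indep_point_processes_def by (rule indep_vars_compose2)
qed (simp_all add: laplace_functional_poisson[OF \<Phi> lam f])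

section \<open>The zeta series over the streets\<close>

lemma riemann_zeta_sums:
  assumes "1 < s"
  shows "(\<lambda>n. 1 / real (Suc n) powr s) sums riemann_zeta s"
proof -
  have "summable (\<lambda>n. real n powr (- s))"
    using assms by (subst summable_real_powr_iff) auto
  then have "summable (\<lambda>n. 1 / real (Suc n) powr s)"
    by (subst (asm) summable_Suc_iff[symmetric]) (simp add: powr_minus_divide)
  then show ?thesis
    unfolding riemann_zeta_def by (rule summable_sums)
qed

text \<open>The square root halves the exponent, so convergence needs
  \<open>\<alpha> / 2 > 1\<close>. Street 0 has coordinate 1 and supplies the leading 1; the others
  give the zeta series.\<close>

lemma sqrt_street_coord_sums:
  assumes "0 < D" "2 < \<alpha>"
  shows "(\<lambda>k. sqrt (street_coord D k powr (- \<alpha>))) sums (1 + riemann_zeta (\<alpha> / 2) * D powr (- \<alpha> / 2))"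
proof -
  have "(\<lambda>n. 1 / real (Suc n) powr (\<alpha> / 2) * D powr (- \<alpha> / 2)) sums
      (riemann_zeta (\<alpha> / 2) * D powr (- \<alpha> / 2))"
    using \<open>2 < \<alpha>\<close> by (intro sums_mult2 riemann_zeta_sums) simp
  moreover have "sqrt (street_coord D (Suc n) powr (- \<alpha>)) = 1 / real (Suc n) powr (\<alpha> / 2) * D powr (- \<alpha> / 2)" for n
  proof -
    have "sqrt (street_coord D (Suc n) powr (- \<alpha>)) = (real (Suc n) * D) powr (- \<alpha> / 2)"
      by (simp add: street_coord_def powr_half_sqrt[symmetric] powr_powr del: of_nat_Suc)
    also have "\<dots> = real (Suc n) powr (- (\<alpha> / 2)) * D powr (- \<alpha> / 2)"
      using \<open>0 < D\<close> by (simp add: powr_mult del: of_nat_Suc)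
    finally show ?thesis
      unfolding powr_minus_divide[of "real (Suc n)"] .
  qed
  ultimately have "(\<lambda>n. sqrt (street_coord D (Suc n) powr (- \<alpha>))) sums
      (riemann_zeta (\<alpha> / 2) * D powr (- \<alpha> / 2))"
    by simp
  then show ?thesis
    by (subst (asm) sums_Suc_iff) (simp add: street_coord_def add.commute)
qed

section \<open>The Laplace transform of the interference\<close>

theorem proposition2:
  fixes M :: "'w measure"
    and lam Pt C D \<alpha> z s :: real
    and \<Phi> :: "nat \<Rightarrow> 'w \<Rightarrow> real set"
    and x h :: "nat \<Rightarrow> nat \<Rightarrow> 'w \<Rightarrow> real"
  assumes "prob_space M"
    and "lam > 0" and "Pt > 0" and "C > 0" and "D > 0" and "\<alpha> > 2"
    and "z = Pt * C"
    and "\<And>k. homogeneous_poisson_process M lam (\<Phi> k)"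
    and "indep_point_processes M \<Phi>"
    and "independent_marking M \<Phi> x h"
    and "\<And>k i. distributed M lborel (h k i) (exponential_density 1)"
    and "s > 0"
  shows "laplace_transform M (interference Pt C D \<alpha> x h) s
           = exp (- pi * lam * (1 + riemann_zeta (\<alpha> / 2) * D powr (- \<alpha> / 2)) * sqrt (s * z))"
proof -
  interpret prob_space M by fact
  define a where "a k = s * z * street_coord D k powr (- \<alpha>)" for k
  define \<phi> where "\<phi> k y = ennreal (a k) * inverse (ennreal (y ^ 2))" for k and y :: real
  define f where "f k y = fading_exponent (\<phi> k y)" for k and y :: real
  define H where "H = (\<lambda>(k, i). h k i)"
  define X where "X = (\<lambda>(k, i). x k i)"
  have "0 < z"
    using \<open>z = Pt * C\<close> \<open>Pt > 0\<close> \<open>C > 0\<close> by simp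
  have a_pos: "0 < a k" for k
    using \<open>s > 0\<close> \<open>0 < z\<close> \<open>D > 0\<close> by (simp add: a_def street_coord_def)
  have [measurable]: "\<phi> k \<in> borel_measurable borel" for k
    unfolding \<phi>_def[abs_def] by measurable
  have [measurable]: "f k \<in> borel_measurable borel" for k
    unfolding f_def[abs_def] by measurable
  have bij: "\<And>k. AE \<omega> in M. bij_betw (\<lambda>i. x k i \<omega>) UNIV (\<Phi> k \<omega>)"
    and H_indep: "indep_vars (\<lambda>_. borel) H UNIV"
    and HX: "indep_var (PiM UNIV (\<lambda>_. borel)) (\<lambda>\<omega> p. H p \<omega>) (PiM UNIV (\<lambda>_. borel)) (\<lambda>\<omega> p. X p \<omega>)"
    using \<open>independent_marking M \<Phi> x h\<close>
    by (auto simp: independent_marking_def H_def X_def case_prod_unfold)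
  have "(\<lambda>\<omega> p. X p \<omega>) \<in> measurable M (PiM UNIV (\<lambda>_. borel))"
    using HX by (simp add: indep_var_distribution_eq)
  then have "(\<lambda>\<omega>. X (k, i) \<omega>) \<in> borel_measurable M" for k i
    by (rule measurable_compose) measurable
  then have [measurable]: "x k i \<in> borel_measurable M" for k i
    by (simp add: X_def)
  \<comment> \<open>All deterministic factors of street \<open>k\<close> are collected in
    \<open>a k\<close>, leaving each mark multiplied by \<open>\<phi> k\<close> at its
    point.\<close>
  have "ennreal s * interference Pt C D \<alpha> x h \<omega>
      = (\<Sum>k. \<Sum>i. \<phi> k (x k i \<omega>) * ennreal (h k i \<omega>))" for \<omega>
  proof -
    have "ennreal s * (ennreal Pt * u * path_loss C \<alpha> y (street_coord D k)) = \<phi> k y * u" for k y u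
      using \<open>s > 0\<close> \<open>Pt > 0\<close> \<open>C > 0\<close>
      by (simp add: path_loss_def \<phi>_def a_def \<open>z = Pt * C\<close> ennreal_mult mult_ac)
    then show ?thesis
      by (simp add: interference_def flip: ennreal_suminf_cmult)
  qed
  then have "laplace_transform M (interference Pt C D \<alpha> x h) s
      = expectation (\<lambda>\<omega>. exp_minus (\<Sum>k. \<Sum>i. \<phi> k (x k i \<omega>) * ennreal (h k i \<omega>)))"
    by (simp add: laplace_transform_def)
  also have "\<dots> = expectation (\<lambda>\<omega>. exp_minus (\<Sum>k. \<Sum>i. f k (x k i \<omega>)))"
    using expectation_exp_minus_marks[OF H_indep HX, of "\<lambda>p. \<phi> (fst p)"] assms(11)
    by (simp add: H_def X_def f_def case_prod_unfold)
  also have "\<dots> = expectation (\<lambda>\<omega>. exp_minus (\<Sum>k. \<integral>\<^sup>+y. f k y \<partial>count_space (\<Phi> k \<omega>)))"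
  proof (rule integral_cong_AE)
    \<comment> \<open>There are countably many streets, so one null set serves them all; off it,
      summing over the enumeration is summing over the random set.\<close>
    have "AE \<omega> in M. \<forall>k. bij_betw (\<lambda>i. x k i \<omega>) UNIV (\<Phi> k \<omega>)"
      using bij by (simp add: AE_all_countable)
    then show "AE \<omega> in M. exp_minus (\<Sum>k. \<Sum>i. f k (x k i \<omega>))
        = exp_minus (\<Sum>k. \<integral>\<^sup>+y. f k y \<partial>count_space (\<Phi> k \<omega>))"
    proof eventually_elim
      case (elim \<omega>)
      have "(\<Sum>i. f k (x k i \<omega>)) = (\<integral>\<^sup>+y. f k y \<partial>count_space (\<Phi> k \<omega>))" for k
        using nn_integral_bij_count_space[of "\<lambda>i. x k i \<omega>" UNIV "\<Phi> k \<omega>" "f k"] elim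
        by (simp add: nn_integral_count_space_nat)
      then show ?case
        by simp
    qed
    have [measurable]: "(\<lambda>\<omega>. \<integral>\<^sup>+y. f k y \<partial>count_space (\<Phi> k \<omega>)) \<in> borel_measurable M" for k
      using assms(8) by (intro measurable_nn_integral_point_process) (auto simp: homogeneous_poisson_process_def)
    show "(\<lambda>\<omega>. exp_minus (\<Sum>k. \<integral>\<^sup>+y. f k y \<partial>count_space (\<Phi> k \<omega>))) \<in> borel_measurable M"
      by measurable
  qed measurable
  also have "\<dots> = exp_minus (\<Sum>k. ennreal lam * (\<integral>\<^sup>+y. ennreal (1 - exp_minus (f k y)) \<partial>lborel))"
    by (rule expectation_exp_minus_suminf_point_processes) (use assms in auto)
  also have "\<dots> = exp_minus (\<Sum>k. ennreal (lam * (pi * sqrt (a k))))"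
    using a_pos \<open>lam > 0\<close>
    by (simp add: f_def \<phi>_def nn_integral_fading_exponent_inverse_square ennreal_mult less_imp_le)
  also have "(\<Sum>k. ennreal (lam * (pi * sqrt (a k))))
      = ennreal (pi * lam * (1 + riemann_zeta (\<alpha> / 2) * D powr (- \<alpha> / 2)) * sqrt (s * z))"
  proof (rule suminf_ennreal_eq)
    show "(\<lambda>k. lam * (pi * sqrt (a k))) sums
        (pi * lam * (1 + riemann_zeta (\<alpha> / 2) * D powr (- \<alpha> / 2)) * sqrt (s * z))"
      using sums_mult[OF sqrt_street_coord_sums[OF \<open>D > 0\<close> \<open>\<alpha> > 2\<close>], of "pi * lam * sqrt (s * z)"]
      by (simp add: a_def real_sqrt_mult mult_ac)
  qed (use \<open>lam > 0\<close> a_pos in \<open>simp add: less_imp_le\<close>)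
  also have "exp_minus \<dots> = exp (- pi * lam * (1 + riemann_zeta (\<alpha> / 2) * D powr (- \<alpha> / 2)) * sqrt (s * z))"
  proof -
    \<comment> \<open>Nonnegativity of the exponent is required because \<open>ennreal\<close>
      truncates negative reals to 0.\<close>
    have "0 \<le> riemann_zeta (\<alpha> / 2)"
      using \<open>\<alpha> > 2\<close> by (intro sums_le[OF _ sums_zero riemann_zeta_sums]) auto
    then show ?thesis
      using \<open>lam > 0\<close> \<open>s > 0\<close> \<open>0 < z\<close> by (simp add: exp_minus_ennreal)
  qed
  finally show ?thesis .
qed

end
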